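(* Let $a_i,b_i,c_i,d_i,e_i$ ($i=0,\ldots,5$) be real numbers. For sufficiently small $\varepsilon>0$ the linear differential system on $\mathbb{S}^2\times\mathbb{S}^2\times\mathbb{R}$ $$\begin{aligned} \dot\theta &= 1+\varepsilon(a_0+a_1\theta+a_2\varphi+a_3\nu+a_4\phi+a_5 r),\\ \dot\varphi &= \varepsilon(b_0+b_1\theta+b_2\varphi+b_3\nu+b_4\phi+b_5 r),\\ \dot\nu &= 1+\varepsilon(c_0+c_1\theta+c_2\varphi+c_3\nu+c_4\phi+c_5 r),\\ \dot\phi &= \varepsilon(d_0+d_1\theta+d_2\varphi+d_3\nu+d_4\phi+d_5 r),\\ \dot r &= r-1+\varepsilon(e_0+e_1\theta+e_2\varphi+e_3\nu+e_4\phi+e_5 r) \end{aligned}$$ has a limit cycle bifurcating from a periodic orbit of the unperturbed system $$\dot\theta=1,\quad\dot\varphi=0,\quad\dot\nu=1,\quad\dot\phi=0,\quad\dot r=r-1,$$ provided that $$\det\begin{pmatrix} a_1 & a_2 & a_3 & a_4 \\ b_1 & b_2 & b_3 & b_4 \\ c_1 & c_2 & c_3 & c_4 \\ d_1 & d_2 & d_3 & d_4 \end{pmatrix}\neq 0.$$ Moreover this limit cycle bifurcates from the periodic orbit of the unperturbed system parameterized by $(\theta(t),\varphi(t),\nu(t),\phi(t),r(t))=(\theta_0+t,\varphi_0,\nu_0+t,\phi_0,1)$, where $(\theta_0,\varphi_0,\nu_0,\phi_0)$ is the unique solution of the linear system $$\begin{aligned} a_1 \theta_0 + a_2 \varphi_0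 + a_3 \nu_0 + a_4 \phi_0 &= -a_0 -a_1 \pi -a_3 \pi -a_5,\\ b_1 \theta_0 + b_2 \varphi_0 + b_3 \nu_0 + b_4 \phi_0 &= -b_0 -b_1 \pi -b_3 \pi -b_5,\\ c_1 \theta_0 + c_2 \varphi_0 + c_3 \nu_0 + c_4 \phi_0 &= -c_0 -c_1 \pi -c_3 \pi -c_5,\\ d_1 \theta_0 + d_2 \varphi_0 + d_3 \nu_0 + d_4 \phi_0 &= -d_0 -d_1 \pi -d_3 \pi -d_5. \end{aligned}$$
   Context: $\mathbb{S}^2$ is the unit two-dimensional sphere, parameterized by an azimuth angle in $[-\pi,\pi)$ and a polar angle in $[-\pi/2,\pi/2]$ (polar angle $0$ is the equator, $\pm\pi/2$ the poles). On $\mathbb{S}^2\times\mathbb{S}^2\times\mathbb{R}$ the coordinates are $(\theta,\varphi,\nu,\phi,r)$, where $(\theta,\varphi)$ are the azimuth and polar angles on the first sphere, $(\nu,\phi)$ those on the second sphere ($\varphi$ and $\phi$ are different variables), and $r\in\mathbb{R}$. A vector field is called linear if in these coordinates $z$ it has the form $X(z)=Az+b$ with $A$ a real $5\times5$ matrix and $b$ a constant vector. The unperturbed system is considered for $\theta,\nu\in[-\pi,\pi)$, $\varphi,\phi\in(-\pi/2,\pi/2)$, $r\in\mathbb{R}$, with $\dot\theta=0$ when $\varphi=\pm\pi/2$ and $\dot\nu=0$ when $\phi=\pm\pi/2$; the perturbed system is its most general perturbation inside the class of linear differential systems, with $\varepsilon>0$ a small parameter. The general solution of the unperturbed system is $\theta(t)=\theta_0+t$,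 $\varphi(t)=\varphi_0$, $\nu(t)=\nu_0+t$, $\phi(t)=\phi_0$, $r(t)=(r_0-1)e^t+1$, so $\{r=1\}\cong(\mathbb{S}^2)^2$ is invariant and is foliated by $2\pi$-periodic orbits, except for the four equilibria $\{r=1,\varphi=\pm\pi/2,\phi=\pm\pi/2\}$. A limit cycle of a differential system is a periodic orbit which is isolated in the set of all periodic orbits of the system. A limit cycle of the perturbed system is said to bifurcate from the periodic orbit of the unperturbed system through the point $z_0$ if, for $\varepsilon>0$ small, it is given by a periodic solution $x(t,\varepsilon)$ of the perturbed system with $x(0,\varepsilon)\to z_0$ as $\varepsilon\to 0$ (here $z_0=(\theta_0,\varphi_0,\nu_0,\phi_0,1)$).
   Formalization: Azimuths are continued past ±π, and limit cycles are isolated only among periodic orbits of period 2π, in a neighbourhood in these coordinates; isolation among all periodic orbits fails. If the polar angles of z0 leave (-π/2,π/2), the claim is in coordinates only. *)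

theory Defs
  imports "HOL-Analysis.Analysis"
begin

text \<open>
  Coordinates (\<open>\<theta>\<close>, \<open>\<phi>\<close>, \<open>\<nu>\<close>, \<open>\<psi>\<close>, \<open>r\<close>) on \<open>S\<^sup>2 \<times> S\<^sup>2 \<times> \<real>\<close>: \<open>\<theta>\<close>, \<open>\<nu>\<close> are azimuths, \<open>\<phi>\<close>, \<open>\<psi>\<close> are
  polar angles measured from the equators of the first and the second sphere.
  A linear field is not periodic in the azimuths, so it is evaluated on azimuths that are
  followed continuously along a solution; azimuths that differ by a multiple of \<open>2\<pi>\<close>
  describe the same point.
\<close>

type_synonym coords = "real \<times> real \<times> real \<times> real \<times> real"

text \<open>The domain of the coordinates: both spheres without their poles.\<close>

fun in_chart :: "coords \<Rightarrow> bool" where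
  "in_chart (\<theta>, \<phi>, \<nu>, \<psi>, r) \<longleftrightarrow> \<phi> \<in> {-(pi/2)<..<pi/2} \<and> \<psi> \<in> {-(pi/2)<..<pi/2}"

definition sphere_point :: "real \<Rightarrow> real \<Rightarrow> real^3" where
  "sphere_point \<theta> \<phi> = vector [cos \<phi> * cos \<theta>, cos \<phi> * sin \<theta>, sin \<phi>]"

fun manifold_point :: "coords \<Rightarrow> (real^3) \<times> (real^3) \<times> real" where
  "manifold_point (\<theta>, \<phi>, \<nu>, \<psi>, r) = (sphere_point \<theta> \<phi>, sphere_point \<nu> \<psi>, r)"

fun same_point :: "coords \<Rightarrow> coords \<Rightarrow> bool" where
  "same_point (\<theta>, \<phi>, \<nu>, \<psi>, r) (\<theta>', \<phi>', \<nu>', \<psi>', r') \<longleftrightarrow>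
     (\<exists>k::int. \<theta> = \<theta>' + 2 * pi * k) \<and> \<phi> = \<phi>' \<and> (\<exists>l::int. \<nu> = \<nu>' + 2 * pi * l) \<and> \<psi> = \<psi>' \<and> r = r'"

lemma sphere_point_in_sphere: "sphere_point \<theta> \<phi> \<in> sphere 0 1"
proof -
  have "(cos \<phi> * cos \<theta>)\<^sup>2 + (cos \<phi> * sin \<theta>)\<^sup>2 = (cos \<phi>)\<^sup>2 * ((cos \<theta>)\<^sup>2 + (sin \<theta>)\<^sup>2)"
    by (simp only: power_mult_distrib distrib_left)
  then have "(cos \<phi> * cos \<theta>)\<^sup>2 + (cos \<phi> * sin \<theta>)\<^sup>2 + (sin \<phi>)\<^sup>2 = 1"
    by simp
  then show ?thesis
    by (simp add: sphere_point_def norm_vec_def L2_set_def sum_3)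
qed

lemma sphere_point_eq_iff:
  assumes "\<phi> \<in> {-(pi/2)<..<pi/2}" "\<phi>' \<in> {-(pi/2)<..<pi/2}"
  shows "sphere_point \<theta> \<phi> = sphere_point \<theta>' \<phi>' \<longleftrightarrow> (\<exists>k::int. \<theta> = \<theta>' + 2 * pi * k) \<and> \<phi> = \<phi>'"
proof -
  have "cos \<phi> > 0"
    using assms(1) by (auto intro!: cos_gt_zero_pi)
  moreover have "sin \<phi> = sin \<phi>' \<longleftrightarrow> \<phi> = \<phi>'"
    using assms sin_inj_pi[of \<phi> \<phi>'] by auto
  ultimately have "sphere_point \<theta> \<phi> = sphere_point \<theta>' \<phi>' \<longleftrightarrow>
      (sin \<theta> = sin \<theta>' \<and> cos \<theta> = cos \<theta>') \<and> \<phi> = \<phi>'"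
    by (auto simp: sphere_point_def vec_eq_iff forall_3)
  then show ?thesis
    by (simp only: sin_cos_eq_iff)
qed

text \<open>In the chart, \<^const>\<open>same_point\<close> is equality of points of \<open>S\<^sup>2 \<times> S\<^sup>2 \<times> \<real>\<close>.\<close>

lemma same_point_iff_manifold_point_eq:
  assumes "in_chart z" "in_chart w"
  shows "same_point z w \<longleftrightarrow> manifold_point z = manifold_point w"
  using assms
  by (cases z; cases w) (auto simp del: greaterThanLessThan_iff simp: sphere_point_eq_iff)

fun affine_form :: "(nat \<Rightarrow> real) \<Rightarrow> coords \<Rightarrow> real" where
  "affine_form a (\<theta>, \<phi>, \<nu>, \<psi>, r) = a 0 + a 1 * \<theta> + a 2 * \<phi> + a 3 * \<nu> + a 4 * \<psi> + a 5 * r"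

fun perturbed_field ::
  "(nat \<Rightarrow> real) \<Rightarrow> (nat \<Rightarrow> real) \<Rightarrow> (nat \<Rightarrow> real) \<Rightarrow> (nat \<Rightarrow> real) \<Rightarrow> (nat \<Rightarrow> real) \<Rightarrow>
    real \<Rightarrow> coords \<Rightarrow> coords" where
  "perturbed_field a b c d e \<epsilon> (\<theta>, \<phi>, \<nu>, \<psi>, r) =
     (1 + \<epsilon> * affine_form a (\<theta>, \<phi>, \<nu>, \<psi>, r),
      \<epsilon> * affine_form b (\<theta>, \<phi>, \<nu>, \<psi>, r),
      1 + \<epsilon> * affine_form c (\<theta>, \<phi>, \<nu>, \<psi>, r),
      \<epsilon> * affine_form d (\<theta>, \<phi>, \<nu>, \<psi>, r),
      r - 1 + \<epsilon> * affine_form e (\<theta>, \<phi>, \<nu>, \<psi>, r))"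

fun unperturbed_field :: "coords \<Rightarrow> coords" where
  "unperturbed_field (\<theta>, \<phi>, \<nu>, \<psi>, r) = (1, 0, 1, 0, r - 1)"

text \<open>
  A periodic solution is given over one period \<open>[0, T]\<close>, after which it is back at the same
  point and its azimuths restart from their initial values.
\<close>

definition periodic_solution :: "(coords \<Rightarrow> coords) \<Rightarrow> real \<Rightarrow> (real \<Rightarrow> coords) \<Rightarrow> bool" where
  "periodic_solution X T z \<longleftrightarrow>
     T > 0 \<and>
     (\<forall>t\<in>{0..T}. (z has_vector_derivative X (z t)) (at t within {0..T})) \<and>
     same_point (z T) (z 0) \<and>
     (\<exists>t\<in>{0..T}. z t \<noteq> z 0)"

text \<open>
  A limit cycle is a periodic orbit with a neighbourhood that contains no other periodic orbit.
  The period \<open>T\<close> is fixed: as the field is not periodic in the azimuths, a closed orbit with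
  azimuths continued from the initial point is in general a member of a family of such orbits
  parameterized by the period.
\<close>

definition limit_cycle :: "(coords \<Rightarrow> coords) \<Rightarrow> real \<Rightarrow> (real \<Rightarrow> coords) \<Rightarrow> bool" where
  "limit_cycle X T z \<longleftrightarrow>
     periodic_solution X T z \<and>
     (\<exists>U. open U \<and> z ` {0..T} \<subseteq> U \<and>
       (\<forall>w. periodic_solution X T w \<and> w ` {0..T} \<subseteq> U \<longrightarrow> w ` {0..T} = z ` {0..T}))"

text \<open>
  If the point \<open>z0\<close> lies in the chart, the limit cycles have to stay in the chart, so that they
  are closed curves on \<open>S\<^sup>2 \<times> S\<^sup>2 \<times> \<real>\<close>; otherwise \<open>z0\<close> only has a meaning in coordinates.
\<close>

definition limit_cycle_bifurcates_from ::
  "(real \<Rightarrow> coords \<Rightarrow> coords) \<Rightarrow> real \<Rightarrow> coords \<Rightarrow> bool" where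
  "limit_cycle_bifurcates_from X T z0 \<longleftrightarrow>
     (\<exists>x. (\<forall>\<^sub>F \<epsilon> in at_right 0. limit_cycle (X \<epsilon>) T (x \<epsilon>)) \<and>
          ((\<lambda>\<epsilon>. x \<epsilon> 0) \<longlongrightarrow> z0) (at_right 0) \<and>
          (in_chart z0 \<longrightarrow> (\<forall>\<^sub>F \<epsilon> in at_right 0. \<forall>t\<in>{0..T}. in_chart (x \<epsilon> t))))"

end

theory Submission
  imports Defs
begin

text \<open>
  Write \<open>u\<close> for the deviation of a solution from the orbit \<open>(\<theta>\<^sub>0 + t, \<phi>\<^sub>0, \<nu>\<^sub>0 + t, \<psi>\<^sub>0, 1)\<close>. It satisfies
  \<open>u' = A u + \<epsilon> f(t)\<close> with \<open>A = diag(0, 0, 0, 0, 1) + O(\<epsilon>)\<close>, and the linear system for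
  \<open>(\<theta>\<^sub>0, \<phi>\<^sub>0, \<nu>\<^sub>0, \<psi>\<^sub>0)\<close> says exactly that the first four components of \<open>f\<close> have mean zero over
  \<open>[0, 2\<pi>]\<close>. Both azimuths of a periodic solution wind once, so periodicity means \<open>u(2\<pi>) = u(0)\<close>.

  Let \<open>S\<close> be the maximum of \<open>|u|\<close>. The first four components oscillate by \<open>O(\<epsilon>(S + 1))\<close>, the last one is
  of that size by hyperbolicity, and averaging the first four equations bounds the first four
  components of \<open>u(0)\<close> in the same way, because the determinant does not vanish.
  Hence \<open>S = O(\<epsilon>(S + 1))\<close>, so \<open>S = O(\<epsilon>)\<close>. For \<open>f = 0\<close> the same argument gives \<open>u = 0\<close>, which is uniqueness, and by linear algebra also existence.
\<close>

section \<open>Linear differential equations with constant coefficients\<close>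

text \<open>The solution is the exponential series with terms
  \<open>(t ^ n / fact n) *\<^sub>R (A ^^ n) c\<close>. It is handled coordinate by coordinate, so
  that termwise differentiation of real power series applies.\<close>

lemma linear_ode_solution_exists:
  fixes A :: "'a::euclidean_space \<Rightarrow> 'a"
  assumes "bounded_linear A"
  shows "\<exists>y. y 0 = c \<and> (\<forall>t. (y has_vector_derivative A (y t)) (at t))"
proof -
  interpret A: bounded_linear A by fact
  obtain K where K: "K > 0" "\<And>x. norm (A x) \<le> norm x * K"
    using A.pos_bounded by blast
  define x where "x n = (A ^^ n) c" for n
  have x_Suc: "x (Suc n) = A (x n)" for n
    by (simp add: x_def)
  have x_bound: "norm (x n) \<le> K ^ n * norm c" for n
  proof (induction n)
    case (Suc n)
    have "norm (x (Suc n)) \<le> norm (x n) * K"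
      using K(2) by (simp add: x_Suc)
    also have "\<dots> \<le> K ^ n * norm c * K"
      using Suc K(1) by (intro mult_right_mono) auto
    finally show ?case by (simp add: algebra_simps)
  qed (simp add: x_def)
  define q where "q i n = (x n \<bullet> i) / fact n" for i n
  have q_summable: "summable (\<lambda>n. q i n * t ^ n)" if "i \<in> Basis" for i t
  proof (rule summable_comparison_test)
    have "norm (q i n * t ^ n) \<le> norm c * ((K * \<bar>t\<bar>) ^ n /\<^sub>R fact n)" for n
    proof -
      have "\<bar>x n \<bullet> i\<bar> \<le> K ^ n * norm c"
        using Basis_le_norm[OF that] x_bound order_trans by blast
      then have "\<bar>x n \<bullet> i\<bar> * \<bar>t\<bar> ^ n \<le> (K ^ n * norm c) * \<bar>t\<bar> ^ n"
        by (rule mult_right_mono) simp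
      then show ?thesis
        by (simp add: q_def abs_mult power_abs power_mult_distrib divide_simps mult_ac)
    qed
    then show "\<exists>N. \<forall>n\<ge>N. norm (q i n * t ^ n) \<le> norm c * ((K * \<bar>t\<bar>) ^ n /\<^sub>R fact n)"
      by blast
    show "summable (\<lambda>n. norm c * ((K * \<bar>t\<bar>) ^ n /\<^sub>R fact n))"
      by (intro summable_mult summable_exp_generic)
  qed
  define y where "y t = (\<Sum>i\<in>Basis. (\<Sum>n. q i n * t ^ n) *\<^sub>R i)" for t
  have y_sums: "(\<lambda>n. (t ^ n / fact n) *\<^sub>R x n) sums y t" for t
  proof -
    have "(\<lambda>n. \<Sum>i\<in>Basis. (q i n * t ^ n) *\<^sub>R i) sums y t"
      unfolding y_def by (intro sums_sum bounded_linear.sums[OF bounded_linear_scaleR_left] summable_sums q_summable)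
    moreover have "(\<Sum>i\<in>Basis. (q i n * t ^ n) *\<^sub>R i) = (t ^ n / fact n) *\<^sub>R x n" for n
    proof -
      have "(t ^ n / fact n) *\<^sub>R x n = (t ^ n / fact n) *\<^sub>R (\<Sum>i\<in>Basis. (x n \<bullet> i) *\<^sub>R i)"
        by (simp add: euclidean_representation)
      then show ?thesis
        by (simp add: scaleR_sum_right q_def mult.commute)
    qed
    ultimately show ?thesis by simp
  qed
  \<comment> \<open>Applying \<open>A\<close> shifts the sequence \<open>x\<close> by one place; on
    Taylor coefficients this is the passage from \<open>q i\<close> to \<open>diffs (q i)\<close>.
    Hence \<open>A (y t)\<close> is the termwise derivative of the series.\<close>
  have Ay_inner: "A (y t) \<bullet> i = (\<Sum>n. diffs (q i) n * t ^ n)" for t i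
  proof -
    have "(\<lambda>n. A ((t ^ n / fact n) *\<^sub>R x n) \<bullet> i) sums (A (y t) \<bullet> i)"
      by (intro bounded_linear.sums[OF bounded_linear_inner_left] A.sums y_sums)
    moreover have "A ((t ^ n / fact n) *\<^sub>R x n) \<bullet> i = diffs (q i) n * t ^ n" for n
      by (simp add: A.scaleR x_Suc[symmetric] diffs_def q_def del: of_nat_Suc)
    ultimately show ?thesis
      by (simp add: sums_iff)
  qed
  have "(y has_vector_derivative (\<Sum>i\<in>Basis. (A (y t) \<bullet> i) *\<^sub>R i)) (at t)" for t
    unfolding y_def[abs_def]
  proof (intro has_vector_derivative_sum)
    fix i :: 'a assume i: "i \<in> Basis"
    have "((\<lambda>t. \<Sum>n. q i n * t ^ n) has_real_derivative A (y t) \<bullet> i) (at t)"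
      unfolding Ay_inner by (rule termdiffs_strong_converges_everywhere[OF q_summable[OF i]])
    then show "((\<lambda>t. (\<Sum>n. q i n * t ^ n) *\<^sub>R i) has_vector_derivative
        (A (\<Sum>i\<in>Basis. (\<Sum>n. q i n * t ^ n) *\<^sub>R i) \<bullet> i) *\<^sub>R i) (at t)"
      unfolding has_real_derivative_iff_has_vector_derivative y_def
      by (rule bounded_linear.has_vector_derivative[OF bounded_linear_scaleR_left])
  qed
  then have "(y has_vector_derivative A (y t)) (at t)" for t
    by (simp add: euclidean_representation)
  moreover have "y 0 = c"
    using sums_unique2[OF y_sums[of 0] sums_finite[of "{0}"]] by (simp add: x_def)
  ultimately show ?thesis by blast
qed

section \<open>Componentwise calculus for curves in the coordinate space\<close>

lemma has_vector_derivative_Pair_iff: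
  fixes u :: "real \<Rightarrow> 'a::real_normed_vector \<times> 'b::real_normed_vector"
  shows "(u has_vector_derivative (x, y)) (at t within S) \<longleftrightarrow>
    ((\<lambda>t. fst (u t)) has_vector_derivative x) (at t within S) \<and>
    ((\<lambda>t. snd (u t)) has_vector_derivative y) (at t within S)"  (is "?L \<longleftrightarrow> ?R1 \<and> ?R2")
proof
  assume "(u has_vector_derivative (x, y)) (at t within S)"
  from bounded_linear.has_vector_derivative[OF bounded_linear_fst this]
    bounded_linear.has_vector_derivative[OF bounded_linear_snd this]
  show "?R1 \<and> ?R2"
    by simp
next
  assume "?R1 \<and> ?R2"
  then have "((\<lambda>t. (fst (u t), snd (u t))) has_derivative (\<lambda>h. (h *\<^sub>R x, h *\<^sub>R y))) (at t within S)"
    unfolding has_vector_derivative_def by (elim conjE) (rule has_derivative_Pair)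
  then show "(u has_vector_derivative (x, y)) (at t within S)"
    by (simp add: has_vector_derivative_def)
qed

lemma coords_fun_cases:
  fixes u :: "real \<Rightarrow> coords"
  obtains u1 u2 u3 u4 u5 where "u = (\<lambda>t. (u1 t, u2 t, u3 t, u4 t, u5 t))"
  using that[of "\<lambda>t. fst (u t)" "\<lambda>t. fst (snd (u t))" "\<lambda>t. fst (snd (snd (u t)))"
      "\<lambda>t. fst (snd (snd (snd (u t))))" "\<lambda>t. snd (snd (snd (snd (u t))))"]
  by simp

lemma mean_value_bound:
  fixes f :: "real \<Rightarrow> real"
  assumes "\<And>t. t \<in> {0..T} \<Longrightarrow> (f has_real_derivative f' t) (at t within {0..T})"
    and "\<And>t. t \<in> {0..T} \<Longrightarrow> \<bar>f' t\<bar> \<le> B" and "s \<in> {0..T}" "t \<in> {0..T}"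
  shows "\<bar>f t - f s\<bar> \<le> B * T"
proof -
  have "\<bar>f t - f s\<bar> \<le> B * \<bar>t - s\<bar>"
    using field_differentiable_bound[of "{0..T}" f f' B t s] assms by auto
  also have "\<dots> \<le> B * T"
    using assms(3,4) order_trans[OF abs_ge_zero assms(2)[OF assms(3)]] by (intro mult_left_mono) auto
  finally show ?thesis .
qed

section \<open>A priori bounds for periodic solutions\<close>

text \<open>The homogeneous part of the perturbed field, with \<open>p1\<close> to \<open>p5\<close>
  as gradients of the affine perturbations. The unperturbed rate \<open>r\<close> is an inner
  product too, so that bounded linearity can be read off.\<close>

definition linear_part :: "coords \<Rightarrow> coords \<Rightarrow> coords \<Rightarrow> coords \<Rightarrow> coords \<Rightarrow> real \<Rightarrow> coords \<Rightarrow> coords" where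
  "linear_part p1 p2 p3 p4 p5 \<epsilon> z =
     (\<epsilon> * (p1 \<bullet> z), \<epsilon> * (p2 \<bullet> z), \<epsilon> * (p3 \<bullet> z), \<epsilon> * (p4 \<bullet> z),
      (0, 0, 0, 0, 1) \<bullet> z + \<epsilon> * (p5 \<bullet> z))"

lemma bounded_linear_linear_part: "bounded_linear (linear_part p1 p2 p3 p4 p5 \<epsilon>)"
  unfolding linear_part_def[abs_def]
  by (intro bounded_linear_Pair bounded_linear_add bounded_linear_const_mult bounded_linear_inner_right)

lemma norm_coords_le: "norm ((x1, x2, x3, x4, x5) :: coords) \<le> \<bar>x1\<bar> + \<bar>x2\<bar> + \<bar>x3\<bar> + \<bar>x4\<bar> + \<bar>x5\<bar>"
proof -
  note * = norm_Pair_le[of _ "_ :: _ :: real_normed_vector"]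
  show ?thesis
    using *[of x1 "(x2, x3, x4, x5)"] *[of x2 "(x3, x4, x5)"] *[of x3 "(x4, x5)"] *[of x4 x5]
    unfolding real_norm_def by linarith
qed

text \<open>The function \<open>exp (- t) * f t\<close> varies by \<open>O(B)\<close>, and periodicity turns this into a bound on \<open>f 0\<close>.\<close>

lemma periodic_hyperbolic_bound:
  fixes f :: "real \<Rightarrow> real"
  assumes der: "\<And>t. t \<in> {0..T} \<Longrightarrow> (f has_real_derivative f t + q t) (at t within {0..T})"
    and q: "\<And>t. t \<in> {0..T} \<Longrightarrow> \<bar>q t\<bar> \<le> B" and per: "f T = f 0" and T: "T > 0" and t: "t \<in> {0..T}"
  shows "\<bar>f t\<bar> \<le> exp T * (T / (1 - exp (-T)) + T) * B"
proof -
  define g where "g t = exp (-t) * f t" for t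
  have B: "B \<ge> 0"
    using q[of 0] T by fastforce
  have dg: "(g has_real_derivative exp (-t) * q t) (at t within {0..T})" if "t \<in> {0..T}" for t
    unfolding g_def by (rule derivative_eq_intros der[OF that] refl | simp add: algebra_simps)+
  have "\<bar>exp (-t) * q t\<bar> \<le> B" if "t \<in> {0..T}" for t
  proof -
    have "exp (-t) * \<bar>q t\<bar> \<le> 1 * B"
      using q[OF that] that by (intro mult_mono) auto
    then show ?thesis by (simp add: abs_mult)
  qed
  note var = mean_value_bound[OF dg this]
  have pos: "1 - exp (-T) > 0"
    using T by simp
  have "\<bar>g T - g 0\<bar> = \<bar>f 0\<bar> * (1 - exp (-T))"
  proof -
    have "g T - g 0 = - (f 0 * (1 - exp (-T)))"
      using per by (simp add: g_def algebra_simps)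
    then show ?thesis
      using pos by (simp add: abs_mult)
  qed
  then have "\<bar>f 0\<bar> * (1 - exp (-T)) \<le> B * T"
    using var[of 0 T] T by simp
  then have f0: "\<bar>f 0\<bar> \<le> B * T / (1 - exp (-T))"
    using pos by (simp add: pos_le_divide_eq)
  have "\<bar>g t\<bar> \<le> B * T / (1 - exp (-T)) + B * T"
    using var[of 0 t] f0 T t by (simp add: g_def)
  moreover have "\<bar>f t\<bar> = exp t * \<bar>g t\<bar>"
    by (simp add: g_def abs_mult exp_minus)
  ultimately have "\<bar>f t\<bar> \<le> exp T * (B * T / (1 - exp (-T)) + B * T)"
    using t by (auto intro: mult_mono)
  then show ?thesis
    by (simp add: algebra_simps)
qed

text \<open>
  The forcing \<open>(t - \<pi>) * g\<close> has mean zero. Averaging the equation therefore shows that the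
  linear form \<open>p\<close> is small at the initial point.
\<close>

lemma averaged_form_bound:
  fixes f :: "real \<Rightarrow> real" and p z0 :: coords
  assumes der: "\<And>t. t \<in> {0..2*pi} \<Longrightarrow>
      (f has_real_derivative \<epsilon> * (p \<bullet> u t + (t - pi) * g)) (at t within {0..2*pi})"
    and per: "f (2*pi) = f 0" and close: "\<And>t. t \<in> {0..2*pi} \<Longrightarrow> norm (u t - z0) \<le> B"
    and \<epsilon>: "\<epsilon> > 0"
  shows "\<bar>p \<bullet> z0\<bar> \<le> norm p * B"
proof -
  \<comment> \<open>From \<open>f\<close> are removed the antiderivative of the forcing and the
    linear growth that \<open>u\<close> would cause if frozen at \<open>z0\<close>; only the effect
    of \<open>u t - z0\<close> remains in the derivative.\<close>
  define y where "y t = f t - \<epsilon> * g * (t\<^sup>2 / 2 - pi * t) - \<epsilon> * (p \<bullet> z0) * t" for t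
  have dy: "(y has_real_derivative \<epsilon> * (p \<bullet> (u t - z0))) (at t within {0..2*pi})"
    if "t \<in> {0..2*pi}" for t
    unfolding y_def by (rule derivative_eq_intros der[OF that] refl | simp add: algebra_simps)+
  have "\<bar>\<epsilon> * (p \<bullet> (u t - z0))\<bar> \<le> \<epsilon> * (norm p * B)" if "t \<in> {0..2*pi}" for t
  proof -
    have "\<bar>p \<bullet> (u t - z0)\<bar> \<le> norm p * B"
      using Cauchy_Schwarz_ineq2[of p "u t - z0"] mult_left_mono[OF close[OF that], of "norm p"]
      by simp
    then show ?thesis
      using \<epsilon> by (simp add: abs_mult)
  qed
  from mean_value_bound[OF dy this, of "2*pi" 0]
  have "\<bar>y (2*pi) - y 0\<bar> \<le> \<epsilon> * (norm p * B) * (2*pi)"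
    by simp
  \<comment> \<open>The polynomial \<open>t\<^sup>2 / 2 - pi * t\<close> vanishes at
    \<open>0\<close> and at \<open>2*pi\<close>, so the forcing has no net effect over the
    period.\<close>
  moreover have "y (2*pi) - y 0 = - (\<epsilon> * (2*pi)) * (p \<bullet> z0)"
    using per by (simp add: y_def algebra_simps power2_eq_square)
  then have "\<bar>y (2*pi) - y 0\<bar> = (\<epsilon> * (2*pi)) * \<bar>p \<bullet> z0\<bar>"
    using \<epsilon> by (simp only: abs_mult abs_minus) simp
  ultimately have "(\<epsilon> * (2*pi)) * \<bar>p \<bullet> z0\<bar> \<le> (\<epsilon> * (2*pi)) * (norm p * B)"
    by (simp only: mult_ac)
  then show ?thesis
    using \<epsilon> by (subst (asm) mult_le_cancel_left_pos) auto
qed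

text \<open>The assumption on \<open>\<kappa>\<close> is the nonvanishing determinant in
  quantitative form. \<open>\<delta>\<close> and \<open>C\<close> are fixed before
  \<open>\<epsilon>\<close>, \<open>u\<close> and the forcing, hence are uniform in them. The case
  \<open>F = 0\<close> yields nonresonance, general \<open>F\<close> the distance from the
  unperturbed orbit.\<close>

lemma periodic_forced_solution_bound:
  fixes p1 p2 p3 p4 p5 :: coords
  assumes \<kappa>: "\<And>x1 x2 x3 x4. \<bar>x1\<bar> + \<bar>x2\<bar> + \<bar>x3\<bar> + \<bar>x4\<bar> \<le> \<kappa> *
      (\<bar>p1 \<bullet> (x1, x2, x3, x4, 0)\<bar> + \<bar>p2 \<bullet> (x1, x2, x3, x4, 0)\<bar> +
       \<bar>p3 \<bullet> (x1, x2, x3, x4, 0)\<bar> + \<bar>p4 \<bullet> (x1, x2, x3, x4, 0)\<bar>)"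
  obtains \<delta> C where "\<delta> > 0" "C > 0"
    "\<And>\<epsilon> u g1 g2 g3 g4 g5 F t. 0 < \<epsilon> \<Longrightarrow> \<epsilon> < \<delta> \<Longrightarrow> u (2*pi) = u 0 \<Longrightarrow>
      (\<And>t. t \<in> {0..2*pi} \<Longrightarrow> (u has_vector_derivative (linear_part p1 p2 p3 p4 p5 \<epsilon> (u t) +
        \<epsilon> *\<^sub>R ((t - pi) * g1, (t - pi) * g2, (t - pi) * g3, (t - pi) * g4, g5 t))) (at t within {0..2*pi})) \<Longrightarrow>
      (\<And>t. t \<in> {0..2*pi} \<Longrightarrow> \<bar>(t - pi) * g1\<bar> \<le> F \<and> \<bar>(t - pi) * g2\<bar> \<le> F \<and> \<bar>(t - pi) * g3\<bar> \<le> F \<and>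
         \<bar>(t - pi) * g4\<bar> \<le> F \<and> \<bar>g5 t\<bar> \<le> F) \<Longrightarrow>
      t \<in> {0..2*pi} \<Longrightarrow> norm (u t) \<le> C * \<epsilon> * F"
proof -
  \<comment> \<open>\<open>H\<close> is the constant of the hyperbolic direction for
    \<open>T = 2*pi\<close>. In \<open>K\<close>, the four slow variations, each with factor
    \<open>2*pi\<close>, add up to \<open>8 * pi\<close>. In \<open>C\<close>, the first summand
    accounts for the initial point, the second for the deviation from it.\<close>
  define N where "N = norm p1 + norm p2 + norm p3 + norm p4 + norm p5"
  define H where "H = exp (2*pi) * (2*pi / (1 - exp (-(2*pi))) + 2*pi)"
  define K where "K = 8 * pi + H"
  define C where "C = \<bar>\<kappa>\<bar> * (N * K) + K"
  have N: "N \<ge> 0" and Np: "norm p1 \<le> N" "norm p2 \<le> N" "norm p3 \<le> N" "norm p4 \<le> N" "norm p5 \<le> N"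
    by (simp_all add: N_def)
  have "H > 0"
    unfolding H_def by (intro mult_pos_pos add_pos_pos divide_pos_pos) auto
  then have K: "K > 0"
    by (simp add: K_def add_pos_pos)
  have C: "C > 0"
    unfolding C_def using N K by (intro add_nonneg_pos mult_nonneg_nonneg) auto
  \<comment> \<open>Ensures \<open>C * N * \<epsilon> \<le> 1/2\<close> for the absorption below;
    the summand \<open>1\<close> keeps the denominator positive.\<close>
  define \<delta> where "\<delta> = 1 / (2 * C * N + 1)"
  have \<delta>: "\<delta> > 0"
    unfolding \<delta>_def using C N by (intro divide_pos_pos add_nonneg_pos mult_nonneg_nonneg) auto
  have "norm (u t) \<le> 2 * C * \<epsilon> * F"
    if \<epsilon>: "0 < \<epsilon>" "\<epsilon> < \<delta>" and per: "u (2*pi) = u 0"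
      and der: "\<And>t. t \<in> {0..2*pi} \<Longrightarrow> (u has_vector_derivative (linear_part p1 p2 p3 p4 p5 \<epsilon> (u t) +
        \<epsilon> *\<^sub>R ((t - pi) * g1, (t - pi) * g2, (t - pi) * g3, (t - pi) * g4, g5 t))) (at t within {0..2*pi})"
      and F: "\<And>t. t \<in> {0..2*pi} \<Longrightarrow> \<bar>(t - pi) * g1\<bar> \<le> F \<and> \<bar>(t - pi) * g2\<bar> \<le> F \<and> \<bar>(t - pi) * g3\<bar> \<le> F \<and>
         \<bar>(t - pi) * g4\<bar> \<le> F \<and> \<bar>g5 t\<bar> \<le> F"
      and t: "t \<in> {0..2*pi}"
    for \<epsilon> and u :: "real \<Rightarrow> coords" and g1 g2 g3 g4 g5 F t
  proof -
    obtain u1 u2 u3 u4 u5 where u: "u = (\<lambda>t. (u1 t, u2 t, u3 t, u4 t, u5 t))"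
      by (rule coords_fun_cases)
    have "continuous_on {0..2*pi} u"
      using der has_vector_derivative_continuous by (fastforce simp: continuous_on_eq_continuous_within)
    then obtain \<tau> where \<tau>: "\<tau> \<in> {0..2*pi}" "\<And>t. t \<in> {0..2*pi} \<Longrightarrow> norm (u t) \<le> norm (u \<tau>)"
      using continuous_attains_sup[of "{0..2*pi}" "\<lambda>t. norm (u t)"] continuous_on_norm by fastforce
    define S where "S = norm (u \<tau>)"
    define E where "E = \<epsilon> * (N * S + F)"
    have form: "\<bar>\<epsilon> * (p \<bullet> u t + q)\<bar> \<le> E" if "t \<in> {0..2*pi}" "norm p \<le> N" "\<bar>q\<bar> \<le> F" for t p q
    proof -
      have "\<bar>p \<bullet> u t\<bar> \<le> norm p * norm (u t)"
        by (rule Cauchy_Schwarz_ineq2)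
      also have "\<dots> \<le> N * S"
        using that \<tau>(2) N by (intro mult_mono) (auto simp: S_def)
      finally show ?thesis
        using \<epsilon>(1) that by (simp add: E_def abs_mult)
    qed
    have d: "(u1 has_real_derivative \<epsilon> * (p1 \<bullet> u t + (t - pi) * g1)) (at t within {0..2*pi})"
        "(u2 has_real_derivative \<epsilon> * (p2 \<bullet> u t + (t - pi) * g2)) (at t within {0..2*pi})"
        "(u3 has_real_derivative \<epsilon> * (p3 \<bullet> u t + (t - pi) * g3)) (at t within {0..2*pi})"
        "(u4 has_real_derivative \<epsilon> * (p4 \<bullet> u t + (t - pi) * g4)) (at t within {0..2*pi})"
        "(u5 has_real_derivative u5 t + \<epsilon> * (p5 \<bullet> u t + g5 t)) (at t within {0..2*pi})"
      if "t \<in> {0..2*pi}" for t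
      using der[OF that]
      unfolding linear_part_def has_real_derivative_iff_has_vector_derivative u
      by (simp_all add: has_vector_derivative_Pair_iff distrib_left add.assoc)
    have per': "u1 (2*pi) = u1 0" "u2 (2*pi) = u2 0" "u3 (2*pi) = u3 0" "u4 (2*pi) = u4 0" "u5 (2*pi) = u5 0"
      using per by (simp_all add: u)
    have var: "\<bar>u1 t - u1 0\<bar> \<le> E * (2*pi)" "\<bar>u2 t - u2 0\<bar> \<le> E * (2*pi)"
        "\<bar>u3 t - u3 0\<bar> \<le> E * (2*pi)" "\<bar>u4 t - u4 0\<bar> \<le> E * (2*pi)" if "t \<in> {0..2*pi}" for t
      using mean_value_bound[OF d(1) form, of 0 t] mean_value_bound[OF d(2) form, of 0 t]
        mean_value_bound[OF d(3) form, of 0 t] mean_value_bound[OF d(4) form, of 0 t] F Np that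
      by auto
    have u5: "\<bar>u5 t\<bar> \<le> H * E" if "t \<in> {0..2*pi}" for t
      unfolding H_def using F Np that per'
      by (intro periodic_hyperbolic_bound[where q = "\<lambda>t. \<epsilon> * (p5 \<bullet> u t + g5 t)"] d(5) form) auto
    \<comment> \<open>The fifth entry is \<open>0\<close> so that the bound with
      \<open>\<kappa>\<close> applies; the fifth component of \<open>u\<close> is small at all times
      and counts as deviation.\<close>
    define z0 :: coords where "z0 = (u1 0, u2 0, u3 0, u4 0, 0)"
    have close: "norm (u t - z0) \<le> K * E" if "t \<in> {0..2*pi}" for t
      using norm_coords_le[of "u1 t - u1 0" "u2 t - u2 0" "u3 t - u3 0" "u4 t - u4 0" "u5 t"]
        var[OF that] u5[OF that]
      by (simp add: u z0_def K_def algebra_simps)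
    have KE: "K * E \<ge> 0"
      using close[of 0] order_trans[OF norm_ge_zero] by fastforce
    have "\<bar>p1 \<bullet> z0\<bar> + \<bar>p2 \<bullet> z0\<bar> + \<bar>p3 \<bullet> z0\<bar> + \<bar>p4 \<bullet> z0\<bar> \<le> N * (K * E)"
    proof -
      have "\<bar>p1 \<bullet> z0\<bar> + \<bar>p2 \<bullet> z0\<bar> + \<bar>p3 \<bullet> z0\<bar> + \<bar>p4 \<bullet> z0\<bar> \<le>
          (norm p1 + norm p2 + norm p3 + norm p4) * (K * E)"
        using averaged_form_bound[OF d(1) per'(1) close \<epsilon>(1)] averaged_form_bound[OF d(2) per'(2) close \<epsilon>(1)]
          averaged_form_bound[OF d(3) per'(3) close \<epsilon>(1)] averaged_form_bound[OF d(4) per'(4) close \<epsilon>(1)]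
        unfolding distrib_right by auto
      also have "\<dots> \<le> N * (K * E)"
        using KE by (intro mult_right_mono) (simp_all add: N_def)
      finally show ?thesis .
    qed
    then have "\<bar>\<kappa>\<bar> * (\<bar>p1 \<bullet> z0\<bar> + \<bar>p2 \<bullet> z0\<bar> + \<bar>p3 \<bullet> z0\<bar> + \<bar>p4 \<bullet> z0\<bar>) \<le> \<bar>\<kappa>\<bar> * (N * (K * E))"
      by (rule mult_left_mono) simp
    moreover have "\<kappa> * (\<bar>p1 \<bullet> z0\<bar> + \<bar>p2 \<bullet> z0\<bar> + \<bar>p3 \<bullet> z0\<bar> + \<bar>p4 \<bullet> z0\<bar>) \<le>
        \<bar>\<kappa>\<bar> * (\<bar>p1 \<bullet> z0\<bar> + \<bar>p2 \<bullet> z0\<bar> + \<bar>p3 \<bullet> z0\<bar> + \<bar>p4 \<bullet> z0\<bar>)"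
      by (intro mult_right_mono) auto
    moreover have "norm z0 \<le> \<kappa> * (\<bar>p1 \<bullet> z0\<bar> + \<bar>p2 \<bullet> z0\<bar> + \<bar>p3 \<bullet> z0\<bar> + \<bar>p4 \<bullet> z0\<bar>)"
      using norm_coords_le[of "u1 0" "u2 0" "u3 0" "u4 0" 0] \<kappa>[of "u1 0" "u2 0" "u3 0" "u4 0"]
      unfolding z0_def by simp
    ultimately have z0: "norm z0 \<le> \<bar>\<kappa>\<bar> * (N * (K * E))"
      by linarith
    have "S \<le> norm z0 + norm (u \<tau> - z0)"
      unfolding S_def using norm_triangle_ineq[of z0 "u \<tau> - z0"] by simp
    also have "\<dots> \<le> C * E"
      using z0 close[OF \<tau>(1)] by (simp add: C_def algebra_simps)
    finally have "S \<le> (C * N * \<epsilon>) * S + C * \<epsilon> * F"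
      by (simp add: E_def algebra_simps)
    \<comment> \<open>\<open>S\<close> occurs on both sides. By the choice of
      \<open>\<delta>\<close> its factor on the right is at most one half, so it can be moved to the
      left, which doubles the constant.\<close>
    moreover have "(C * N * \<epsilon>) * S \<le> (1/2) * S"
    proof (rule mult_right_mono)
      have "\<epsilon> * (2 * C * N + 1) < 1"
        using \<epsilon>(2) C N by (simp add: \<delta>_def pos_less_divide_eq add_nonneg_pos)
      then show "C * N * \<epsilon> \<le> 1/2"
        using \<epsilon>(1) by (simp add: algebra_simps)
      show "S \<ge> 0" by (simp add: S_def)
    qed
    ultimately have "S \<le> 2 * C * \<epsilon> * F"
      by simp
    then show ?thesis
      using \<tau>(2)[OF t] by (simp add: S_def)
  qed
  then show thesis
    using that[of \<delta> "2 * C"] \<delta> C by auto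
qed

section \<open>Existence of solutions with a prescribed increment\<close>

text \<open>
  Fredholm alternative. Nonresonance makes the linear maps \<open>A\<close> and \<open>c \<mapsto> \<Phi>\<^sub>T c - c\<close> injective,
  hence surjective, where \<open>\<Phi>\<close> is the flow of \<open>A\<close>; then an equilibrium plus a trajectory
  of \<open>\<Phi>\<close> has the required increment.
\<close>

lemma nonresonant_affine_solution_with_increment:
  fixes A :: "'a::euclidean_space \<Rightarrow> 'a"
  assumes A: "bounded_linear A" and T: "T > 0"
    and nonres: "\<And>u t. u T = u 0 \<Longrightarrow>
      (\<And>t. t \<in> {0..T} \<Longrightarrow> (u has_vector_derivative A (u t)) (at t within {0..T})) \<Longrightarrow>
      t \<in> {0..T} \<Longrightarrow> u t = 0"
  shows "\<exists>z. z T = z 0 + h \<and> (\<forall>t. (z has_vector_derivative A (z t) + \<beta>) (at t))"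
proof -
  interpret A: bounded_linear A by fact
  \<comment> \<open>A vector in the kernel of \<open>A\<close> is a constant, hence periodic,
    solution.\<close>
  have "inj A"
  proof (rule linear_injective_0[OF A.linear, THEN iffD2], intro allI impI)
    fix x assume "A x = 0"
    then show "x = 0"
      using nonres[of "\<lambda>_. x" 0] T by auto
  qed
  then obtain z0 where z0: "A z0 = - \<beta>"
    using linear_injective_imp_surjective[OF A.linear] by (metis surjD)
  obtain y where y: "\<And>c. y c 0 = c" "\<And>c t. (y c has_vector_derivative A (y c t)) (at t)"
    using linear_ode_solution_exists[OF A] by metis
  \<comment> \<open>Solutions are picked for the basis vectors only and extended linearly. Linearity
    in the initial value then holds by construction, without an appeal to uniqueness of
    solutions.\<close>
  define \<Phi> where "\<Phi> c t = (\<Sum>i\<in>Basis. (c \<bullet> i) *\<^sub>R y i t)" for c t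
  have \<Phi>_0: "\<Phi> c 0 = c" for c
    by (simp add: \<Phi>_def y euclidean_representation)
  have \<Phi>_der: "(\<Phi> c has_vector_derivative A (\<Phi> c t)) (at t)" for c t
    unfolding \<Phi>_def[abs_def] A.sum A.scaleR
    by (intro has_vector_derivative_sum bounded_linear.has_vector_derivative[OF bounded_linear_scaleR_right] y)
  have lin: "linear (\<lambda>c. \<Phi> c T - c)"
    unfolding \<Phi>_def
    by (intro linearI)
      (simp_all add: inner_add_left scaleR_add_left sum.distrib scaleR_right_diff_distrib scaleR_sum_right)
  have "inj (\<lambda>c. \<Phi> c T - c)"
  proof (rule linear_injective_0[OF lin, THEN iffD2], intro allI impI)
    fix c assume "\<Phi> c T - c = 0"
    then show "c = 0"
      using nonres[of "\<Phi> c" 0] \<Phi>_der \<Phi>_0 T has_vector_derivative_at_within by fastforce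
  qed
  then obtain c where c: "\<Phi> c T - c = h"
    using surjD[OF linear_injective_imp_surjective[OF lin], of h] by auto
  define z where "z t = z0 + \<Phi> c t" for t
  have "(z has_vector_derivative A (z t) + \<beta>) (at t)" for t
    unfolding z_def using \<Phi>_der[of c t] by (auto simp: A.add z0 intro!: derivative_eq_intros)
  moreover have "z T = z 0 + h"
    using c by (simp add: z_def \<Phi>_0 algebra_simps)
  ultimately show ?thesis by blast
qed

section \<open>Quantitative invertibility of a matrix\<close>

lemma vector_4 [simp]:
  "(vector [w, x, y, z] :: ('a::zero)^4) $ 1 = w"
  "(vector [w, x, y, z] :: ('a::zero)^4) $ 2 = x"
  "(vector [w, x, y, z] :: ('a::zero)^4) $ 3 = y"
  "(vector [w, x, y, z] :: ('a::zero)^4) $ 4 = z"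
  unfolding vector_def by simp_all

text \<open>With a left inverse \<open>M'\<close>, which is bounded, \<open>x\<close> is
  \<open>M' *v (M *v x)\<close>; comparing the sum norm with the Euclidean norm costs a factor
  \<open>CARD('n)\<close>. Through this bound the determinant enters the estimates.\<close>

lemma invertible_imp_l1_bounded_below:
  fixes M :: "real^'n^'n"
  assumes "invertible M"
  shows "\<exists>\<kappa>. \<forall>x. (\<Sum>i\<in>UNIV. \<bar>x $ i\<bar>) \<le> \<kappa> * (\<Sum>i\<in>UNIV. \<bar>(M *v x) $ i\<bar>)"
proof -
  obtain M' where M': "M' ** M = mat 1"
    using assms by (auto simp: invertible_def)
  obtain K where K: "K > 0" "\<And>x. norm (M' *v x) \<le> norm x * K"
    using bounded_linear.pos_bounded[OF matrix_vector_mul_bounded_linear[of M']] by blast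
  have "(\<Sum>i\<in>UNIV. \<bar>x $ i\<bar>) \<le> (real CARD('n) * K) * (\<Sum>i\<in>UNIV. \<bar>(M *v x) $ i\<bar>)" for x
  proof -
    have "(\<Sum>i\<in>UNIV. \<bar>x $ i\<bar>) \<le> real CARD('n) * norm x"
      using sum_bounded_above[of UNIV "\<lambda>i. \<bar>x $ i\<bar>" "norm x"] component_le_norm_cart by auto
    also have "norm x \<le> norm (M *v x) * K"
      using K(2)[of "M *v x"] by (simp add: matrix_vector_mul_assoc M')
    also have "\<dots> \<le> (\<Sum>i\<in>UNIV. \<bar>(M *v x) $ i\<bar>) * K"
      using K(1) by (intro mult_right_mono norm_le_l1_cart) auto
    finally show ?thesis by (simp add: mult_ac)
  qed
  then show ?thesis by blast
qed

section \<open>The perturbed field and the winding of its periodic solutions\<close>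

text \<open>The gradient of \<open>affine_form a\<close>; the constant term \<open>a 0\<close> goes
  into the inhomogeneity.\<close>

definition coeffs :: "(nat \<Rightarrow> real) \<Rightarrow> coords" where
  "coeffs a = (a 1, a 2, a 3, a 4, a 5)"

lemma affine_form_eq_inner: "affine_form a z = a 0 + coeffs a \<bullet> z"
  by (cases z) (simp add: coeffs_def)

lemma perturbed_field_eq:
  "perturbed_field a b c d e \<epsilon> z =
     linear_part (coeffs a) (coeffs b) (coeffs c) (coeffs d) (coeffs e) \<epsilon> z +
     (1 + \<epsilon> * a 0, \<epsilon> * b 0, 1 + \<epsilon> * c 0, \<epsilon> * d 0, \<epsilon> * e 0 - 1)"
  by (cases z) (simp add: coeffs_def linear_part_def algebra_simps)

text \<open>Near the orbit the azimuths advance with speed close to \<open>1\<close>, so they wind exactly once.\<close>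

lemma periodic_solution_increment:
  assumes w: "periodic_solution (perturbed_field a b c d e \<epsilon>) (2*pi) w"
    and small: "\<And>t. t \<in> {0..2*pi} \<Longrightarrow>
      \<bar>\<epsilon> * affine_form a (w t)\<bar> \<le> 1/2 \<and> \<bar>\<epsilon> * affine_form c (w t)\<bar> \<le> 1/2"
  shows "w (2*pi) = w 0 + (2*pi, 0, 2*pi, 0, 0)"
proof -
  obtain w1 w2 w3 w4 w5 where w_eq: "w = (\<lambda>t. (w1 t, w2 t, w3 t, w4 t, w5 t))"
    by (rule coords_fun_cases)
  have der: "(w has_vector_derivative perturbed_field a b c d e \<epsilon> (w t)) (at t within {0..2*pi})"
    if "t \<in> {0..2*pi}" for t
    using w that by (simp add: periodic_solution_def)
  have d: "(w1 has_real_derivative 1 + \<epsilon> * affine_form a (w t)) (at t within {0..2*pi})"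
    "(w3 has_real_derivative 1 + \<epsilon> * affine_form c (w t)) (at t within {0..2*pi})"
    if "t \<in> {0..2*pi}" for t
    using der[OF that] unfolding w_eq has_real_derivative_iff_has_vector_derivative
    by (simp_all add: has_vector_derivative_Pair_iff)
  \<comment> \<open>Over one period \<open>f t - t\<close> changes by at most
    \<open>1/2 * (2*pi) = pi\<close>, while its increment is an integer multiple of
    \<open>2*pi\<close>; so the increment is \<open>0\<close>.\<close>
  have wind: "f (2*pi) = f 0 + 2*pi"
    if df: "\<And>t. t \<in> {0..2*pi} \<Longrightarrow> (f has_real_derivative 1 + q t) (at t within {0..2*pi})"
      and q: "\<And>t. t \<in> {0..2*pi} \<Longrightarrow> \<bar>q t\<bar> \<le> 1/2"
      and k: "f (2*pi) = f 0 + 2 * pi * real_of_int k" for f q k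
  proof -
    have "((\<lambda>t. f t - t) has_real_derivative q t) (at t within {0..2*pi})" if "t \<in> {0..2*pi}" for t
      by (rule derivative_eq_intros df[OF that] refl | simp)+
    from mean_value_bound[OF this q, of 0 "2*pi"]
    have "\<bar>f (2*pi) - 2*pi - f 0\<bar> \<le> pi"
      by simp
    moreover have "f (2*pi) - 2*pi - f 0 = 2 * pi * (real_of_int k - 1)"
      unfolding k by (simp add: algebra_simps)
    ultimately have "\<bar>2 * pi * (real_of_int k - 1)\<bar> \<le> pi"
      by simp
    then have "pi * (2 * \<bar>real_of_int k - 1\<bar>) \<le> pi * 1"
      by (simp add: abs_mult)
    then have "2 * \<bar>real_of_int k - 1\<bar> \<le> 1"
      by (subst (asm) mult_le_cancel_left_pos) auto
    then have "real_of_int \<bar>k - 1\<bar> < real_of_int 1"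
      by simp
    then have "k = 1"
      unfolding of_int_less_iff by simp
    then show ?thesis
      using k by simp
  qed
  have "same_point (w (2*pi)) (w 0)"
    using w by (simp add: periodic_solution_def)
  then obtain k l :: int where kl: "w1 (2*pi) = w1 0 + 2 * pi * k" "w3 (2*pi) = w3 0 + 2 * pi * l"
    and eq: "w2 (2*pi) = w2 0" "w4 (2*pi) = w4 0" "w5 (2*pi) = w5 0"
    by (auto simp: w_eq)
  have "w1 (2*pi) = w1 0 + 2*pi" "w3 (2*pi) = w3 0 + 2*pi"
    using wind[OF d(1) _ kl(1)] wind[OF d(2) _ kl(2)] small by auto
  then show ?thesis
    using eq by (simp add: w_eq)
qed

section \<open>The limit cycle near the unperturbed orbit\<close>

text \<open>By \<open>sol\<close> the four slow perturbations vanish at the midpoint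
  \<open>t = pi\<close> of the unperturbed orbit. As they are affine in \<open>t\<close> along it,
  their means over the period vanish. The bound \<open>C * \<epsilon>\<close>, uniform in
  \<open>t\<close>, serves both the convergence of the initial points and the stay in the
  chart.\<close>

lemma perturbed_limit_cycle_near:
  fixes a b c d e :: "nat \<Rightarrow> real"
  assumes \<kappa>: "\<And>x1 x2 x3 x4. \<bar>x1\<bar> + \<bar>x2\<bar> + \<bar>x3\<bar> + \<bar>x4\<bar> \<le> \<kappa> *
      (\<bar>coeffs a \<bullet> (x1, x2, x3, x4, 0)\<bar> + \<bar>coeffs b \<bullet> (x1, x2, x3, x4, 0)\<bar> +
       \<bar>coeffs c \<bullet> (x1, x2, x3, x4, 0)\<bar> + \<bar>coeffs d \<bullet> (x1, x2, x3, x4, 0)\<bar>)"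
    and sol: "affine_form a (\<theta>0 + pi, \<phi>0, \<nu>0 + pi, \<psi>0, 1) = 0" "affine_form b (\<theta>0 + pi, \<phi>0, \<nu>0 + pi, \<psi>0, 1) = 0"
      "affine_form c (\<theta>0 + pi, \<phi>0, \<nu>0 + pi, \<psi>0, 1) = 0" "affine_form d (\<theta>0 + pi, \<phi>0, \<nu>0 + pi, \<psi>0, 1) = 0"
  obtains \<delta> C where "\<delta> > 0"
    "\<And>\<epsilon>. 0 < \<epsilon> \<Longrightarrow> \<epsilon> < \<delta> \<Longrightarrow> \<exists>z. limit_cycle (perturbed_field a b c d e \<epsilon>) (2*pi) z \<and>
       (\<forall>t\<in>{0..2*pi}. norm (z t - (\<theta>0 + t, \<phi>0, \<nu>0 + t, \<psi>0, 1)) \<le> C * \<epsilon>)"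
proof -
  define L where "L = linear_part (coeffs a) (coeffs b) (coeffs c) (coeffs d) (coeffs e)"
  \<comment> \<open>The velocity of the unperturbed orbit. That both azimuths wind once and the
    other coordinates return means an increment of \<open>(2*pi) *\<^sub>R h\<close>.\<close>
  define h :: coords where "h = (1, 0, 1, 0, 0)"
  obtain \<delta>1 C1 where \<delta>1: "\<delta>1 > 0" "C1 > 0" and bound:
    "\<And>\<epsilon> u g1 g2 g3 g4 g5 F t. 0 < \<epsilon> \<Longrightarrow> \<epsilon> < \<delta>1 \<Longrightarrow> u (2*pi) = u 0 \<Longrightarrow>
      (\<And>t. t \<in> {0..2*pi} \<Longrightarrow> (u has_vector_derivative (L \<epsilon> (u t) +
        \<epsilon> *\<^sub>R ((t - pi) * g1, (t - pi) * g2, (t - pi) * g3, (t - pi) * g4, g5 t))) (at t within {0..2*pi})) \<Longrightarrow>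
      (\<And>t. t \<in> {0..2*pi} \<Longrightarrow> \<bar>(t - pi) * g1\<bar> \<le> F \<and> \<bar>(t - pi) * g2\<bar> \<le> F \<and> \<bar>(t - pi) * g3\<bar> \<le> F \<and>
         \<bar>(t - pi) * g4\<bar> \<le> F \<and> \<bar>g5 t\<bar> \<le> F) \<Longrightarrow>
      t \<in> {0..2*pi} \<Longrightarrow> norm (u t) \<le> C1 * \<epsilon> * F"
    using periodic_forced_solution_bound[OF \<kappa>] unfolding L_def by metis
  have nonres: "u t = 0"
    if "0 < \<epsilon>" "\<epsilon> < \<delta>1" "u (2*pi) = u 0" "t \<in> {0..2*pi}"
      "\<And>t. t \<in> {0..2*pi} \<Longrightarrow> (u has_vector_derivative L \<epsilon> (u t)) (at t within {0..2*pi})" for \<epsilon> u t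
    using bound[of \<epsilon> u 0 0 0 0 "\<lambda>_. 0" 0 t] that by (simp flip: zero_prod_def)
  define z0 :: "real \<Rightarrow> coords" where "z0 t = (\<theta>0 + t, \<phi>0, \<nu>0 + t, \<psi>0, 1)" for t
  have z0_shift: "z0 t = z0 pi + (t - pi) *\<^sub>R h" for t
    by (simp add: z0_def h_def)
  define G where "G = norm (coeffs a) + norm (coeffs b) + norm (coeffs c) + norm (coeffs d) + norm (coeffs e)"
  define Z where "Z = norm (z0 pi) + pi * norm h"
  have z0_bound: "norm (z0 t) \<le> Z" if "t \<in> {0..2*pi}" for t
  proof -
    have "norm (z0 t) \<le> norm (z0 pi) + \<bar>t - pi\<bar> * norm h"
      unfolding z0_shift[of t] using norm_triangle_ineq[of "z0 pi" "(t - pi) *\<^sub>R h"] by simp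
    also have "\<dots> \<le> Z"
      unfolding Z_def using that by (intro add_left_mono mult_right_mono) (auto simp: abs_if)
    finally show ?thesis .
  qed
  have form_bound: "\<bar>coeffs f \<bullet> x\<bar> \<le> G * B"
    if "f \<in> {a, b, c, d, e}" "norm x \<le> B" for f x B
  proof -
    have "\<bar>coeffs f \<bullet> x\<bar> \<le> norm (coeffs f) * norm x"
      by (rule Cauchy_Schwarz_ineq2)
    also have "\<dots> \<le> G * B"
      using that by (intro mult_mono) (auto simp: G_def)
    finally show ?thesis .
  qed
  \<comment> \<open>\<open>F\<close> bounds the forcing: its first summand the slow components, the
    others the fifth. \<open>B\<close> bounds the forms of \<open>a\<close> and \<open>c\<close>
    along the cycle when \<open>\<epsilon> < 1\<close>; the last entry of \<open>\<delta>\<close>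
    then keeps the azimuth speeds within \<open>1/2\<close> of \<open>1\<close>.\<close>
  define F where "F = pi * (G * norm h) + \<bar>e 0\<bar> + G * Z"
  define C where "C = C1 * F"
  define B where "B = \<bar>a 0\<bar> + \<bar>c 0\<bar> + G * (Z + C)"
  define \<delta> where "\<delta> = min (min \<delta>1 1) (1 / (4 * (\<bar>B\<bar> + 1)))"
  have G: "G \<ge> 0" and Z: "Z \<ge> 0"
    by (simp_all add: G_def Z_def)
  have F: "F \<ge> 0"
    unfolding F_def using G Z by (intro add_nonneg_nonneg mult_nonneg_nonneg) auto
  have "\<delta> > 0"
    using \<delta>1 by (simp add: \<delta>_def)
  moreover have "\<exists>z. limit_cycle (perturbed_field a b c d e \<epsilon>) (2*pi) z \<and>
       (\<forall>t\<in>{0..2*pi}. norm (z t - (\<theta>0 + t, \<phi>0, \<nu>0 + t, \<psi>0, 1)) \<le> C * \<epsilon>)"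
    if \<epsilon>: "0 < \<epsilon>" "\<epsilon> < \<delta>" for \<epsilon>
  proof -
    interpret L: bounded_linear "L \<epsilon>"
      unfolding L_def by (rule bounded_linear_linear_part)
    define \<beta> where "\<beta> = (1 + \<epsilon> * a 0, \<epsilon> * b 0, 1 + \<epsilon> * c 0, \<epsilon> * d 0, \<epsilon> * e 0 - 1)"
    have X: "perturbed_field a b c d e \<epsilon> x = L \<epsilon> x + \<beta>" for x
      by (simp add: perturbed_field_eq L_def \<beta>_def)
    have \<epsilon>1: "\<epsilon> < \<delta>1" "\<epsilon> < 1" "\<epsilon> * (4 * (\<bar>B\<bar> + 1)) < 1"
      using \<epsilon>(2) by (simp_all add: \<delta>_def pos_less_divide_eq)
    obtain z where z_inc: "z (2*pi) = z 0 + (2*pi) *\<^sub>R h"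
      and z_der: "\<And>t. (z has_vector_derivative L \<epsilon> (z t) + \<beta>) (at t)"
      using nonresonant_affine_solution_with_increment[OF L.bounded_linear_axioms, of "2*pi" "(2*pi) *\<^sub>R h" \<beta>]
        nonres[OF \<epsilon>(1) \<epsilon>1(1)] by auto
    have z_der': "(z has_vector_derivative L \<epsilon> (z t) + \<beta>) (at t within S)" for t S
      using z_der has_vector_derivative_at_within by blast
    define u where "u t = z t - z0 t" for t
    have z_near: "norm (u t) \<le> C * \<epsilon>" if t: "t \<in> {0..2*pi}" for t
    proof -
      have forcing: "L \<epsilon> (z t) + \<beta> - h = L \<epsilon> (u t) + \<epsilon> *\<^sub>R
         ((t - pi) * (coeffs a \<bullet> h), (t - pi) * (coeffs b \<bullet> h), (t - pi) * (coeffs c \<bullet> h),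
          (t - pi) * (coeffs d \<bullet> h), affine_form e (z0 t))" for t
      proof -
        \<comment> \<open>The value at \<open>t = pi\<close> vanishes, so only the change of the
          form in the direction \<open>h\<close> is left.\<close>
        have "affine_form f (z0 t) = (t - pi) * (coeffs f \<bullet> h)" if "affine_form f (z0 pi) = 0" for f
          using that unfolding z0_shift[of t] affine_form_eq_inner by (simp add: inner_add_right)
        note eqs = this[of a] this[of b] this[of c] this[of d]
        \<comment> \<open>On the orbit \<open>r = 1\<close>, so the field differs from
          \<open>h\<close> only by the perturbation.\<close>
        have "L \<epsilon> (z0 t) + \<beta> - h = \<epsilon> *\<^sub>R (affine_form a (z0 t), affine_form b (z0 t),
            affine_form c (z0 t), affine_form d (z0 t), affine_form e (z0 t))"
          unfolding X[symmetric] by (simp add: z0_def h_def del: affine_form.simps)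
        then have "L \<epsilon> (z0 t) + \<beta> - h = \<epsilon> *\<^sub>R
           ((t - pi) * (coeffs a \<bullet> h), (t - pi) * (coeffs b \<bullet> h), (t - pi) * (coeffs c \<bullet> h),
            (t - pi) * (coeffs d \<bullet> h), affine_form e (z0 t))"
          using eqs sol by (simp only: z0_def[of pi])
        then show ?thesis
          by (simp add: u_def L.diff algebra_simps)
      qed
      have "(z0 has_vector_derivative h) (at t within S)" for t S
      proof -
        have "((\<lambda>t. z0 pi + (t - pi) *\<^sub>R h) has_vector_derivative h) (at t within S)"
          by (auto intro!: derivative_eq_intros)
        then show ?thesis
          by (simp flip: z0_shift)
      qed
      then have u_der: "(u has_vector_derivative L \<epsilon> (u t) + \<epsilon> *\<^sub>R
         ((t - pi) * (coeffs a \<bullet> h), (t - pi) * (coeffs b \<bullet> h), (t - pi) * (coeffs c \<bullet> h),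
          (t - pi) * (coeffs d \<bullet> h), affine_form e (z0 t))) (at t within S)" for t S
        unfolding u_def[abs_def] forcing[symmetric, unfolded u_def]
        by (intro has_vector_derivative_diff z_der')
      have u_per: "u (2*pi) = u 0"
        unfolding u_def z_inc by (simp add: z0_def h_def)
      have mean0: "\<bar>(t - pi) * (coeffs f \<bullet> h)\<bar> \<le> F" if "t \<in> {0..2*pi}" "f \<in> {a, b, c, d, e}" for t f
      proof -
        have "\<bar>(t - pi) * (coeffs f \<bullet> h)\<bar> \<le> pi * (G * norm h)"
          unfolding abs_mult using that form_bound by (intro mult_mono) (auto simp: abs_if)
        also have "\<dots> \<le> F"
          using G Z by (simp add: F_def)
        finally show ?thesis .
      qed
      have "\<bar>affine_form e (z0 t)\<bar> \<le> F" if "t \<in> {0..2*pi}" for t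
      proof -
        have "\<bar>affine_form e (z0 t)\<bar> \<le> \<bar>e 0\<bar> + G * Z"
          using form_bound[of e "z0 t" Z] z0_bound[OF that] by (auto simp: affine_form_eq_inner)
        also have "\<dots> \<le> F"
          using G by (simp add: F_def)
        finally show ?thesis .
      qed
      then have "norm (u t) \<le> C1 * \<epsilon> * F"
        using mean0 by (intro bound[OF \<epsilon>(1) \<epsilon>1(1) u_per u_der _ t]) auto
      then show ?thesis
        by (simp add: C_def mult_ac)
    qed
    have small: "\<bar>\<epsilon> * affine_form f (z t)\<bar> < 1/2" if "t \<in> {0..2*pi}" "f \<in> {a, c}" for t f
    proof -
      have "C * \<epsilon> \<le> C"
        using \<epsilon>1(2) \<delta>1(2) F by (simp add: C_def mult_left_le)
      then have "norm (z t) \<le> Z + C"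
        using norm_triangle_ineq[of "z0 t" "u t"] z0_bound z_near that by (fastforce simp: u_def)
      then have "\<bar>coeffs f \<bullet> z t\<bar> \<le> G * (Z + C)"
        using that(2) by (intro form_bound) auto
      then have "\<bar>affine_form f (z t)\<bar> \<le> \<bar>B\<bar>"
        using that(2) by (auto simp: affine_form_eq_inner B_def)
      then have "\<epsilon> * \<bar>affine_form f (z t)\<bar> \<le> \<epsilon> * \<bar>B\<bar>"
        using \<epsilon> by (intro mult_left_mono) auto
      also have "\<dots> < 1/2"
        using \<epsilon>1(3) \<epsilon>(1) by (simp add: algebra_simps)
      finally show ?thesis
        using \<epsilon>(1) by (simp add: abs_mult)
    qed
    \<comment> \<open>On \<open>U\<close> both azimuth speeds differ from \<open>1\<close> by less
      than \<open>1/2\<close>, which forces every periodic solution inside \<open>U\<close> to wind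
      once. Strict inequalities make \<open>U\<close> open; it need not be a thin tube around the
      cycle.\<close>
    define U where "U = {x. \<bar>\<epsilon> * affine_form a x\<bar> < 1/2} \<inter> {x. \<bar>\<epsilon> * affine_form c x\<bar> < 1/2}"
    have U_open: "open U"
      unfolding U_def affine_form_eq_inner
      by (intro open_Int open_Collect_less continuous_intros)
    have U_orbit: "z ` {0..2*pi} \<subseteq> U"
      using small by (auto simp: U_def)
    have z_sol: "periodic_solution (perturbed_field a b c d e \<epsilon>) (2*pi) z"
      unfolding periodic_solution_def X
    proof (intro conjI ballI)
      show "same_point (z (2*pi)) (z 0)"
        unfolding z_inc h_def by (cases "z 0") (auto intro!: exI[of _ 1])
      show "\<exists>t\<in>{0..2*pi}. z t \<noteq> z 0"
        by (rule bexI[of _ "2*pi"]) (auto simp: z_inc h_def prod_eq_iff)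
    qed (use z_der' in auto)
    have z_unique: "w ` {0..2*pi} = z ` {0..2*pi}"
      if w: "periodic_solution (perturbed_field a b c d e \<epsilon>) (2*pi) w" and U: "w ` {0..2*pi} \<subseteq> U" for w
    proof -
      have "w (2*pi) = w 0 + (2*pi) *\<^sub>R h"
        using periodic_solution_increment[OF w] U by (fastforce simp: U_def h_def image_subset_iff)
      \<comment> \<open>Equal increments cancel, so \<open>w - z\<close> is a periodic solution of
        the homogeneous equation and vanishes by nonresonance. The curves then agree at each time,
        not only as sets.\<close>
      then have per: "w (2*pi) - z (2*pi) = w 0 - z 0"
        by (simp add: z_inc)
      have der: "((\<lambda>t. w t - z t) has_vector_derivative L \<epsilon> (w t - z t)) (at t within {0..2*pi})"
        if "t \<in> {0..2*pi}" for t
      proof -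
        have "(w has_vector_derivative L \<epsilon> (w t) + \<beta>) (at t within {0..2*pi})"
          using w that by (simp add: periodic_solution_def X)
        from has_vector_derivative_diff[OF this z_der'] show ?thesis
          by (simp add: L.diff)
      qed
      have "w t = z t" if "t \<in> {0..2*pi}" for t
        using nonres[OF \<epsilon>(1) \<epsilon>1(1) per that der] by simp
      then show ?thesis
        by (intro image_cong) auto
    qed
    have "limit_cycle (perturbed_field a b c d e \<epsilon>) (2*pi) z"
      unfolding limit_cycle_def
      by (intro conjI exI[of _ U] allI impI z_sol U_open U_orbit) (elim conjE, rule z_unique)
    then show ?thesis
      using z_near by (auto simp: u_def z0_def)
  qed
  ultimately show thesis
    using that[of \<delta> C] by blast
qed

section \<open>From the determinant to the bifurcating limit cycle\<close>

theorem theorem2: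
  fixes a b c d e :: "nat \<Rightarrow> real"
  assumes "det (vector [vector [a 1, a 2, a 3, a 4],
                        vector [b 1, b 2, b 3, b 4],
                        vector [c 1, c 2, c 3, c 4],
                        vector [d 1, d 2, d 3, d 4]] :: real^4^4) \<noteq> 0"
  shows "\<exists>\<theta>0 \<phi>0 \<nu>0 \<psi>0.
    (\<forall>\<theta> \<phi> \<nu> \<psi>.
       (a 1 * \<theta> + a 2 * \<phi> + a 3 * \<nu> + a 4 * \<psi> = - a 0 - a 1 * pi - a 3 * pi - a 5 \<and>
        b 1 * \<theta> + b 2 * \<phi> + b 3 * \<nu> + b 4 * \<psi> = - b 0 - b 1 * pi - b 3 * pi - b 5 \<and>
        c 1 * \<theta> + c 2 * \<phi> + c 3 * \<nu> + c 4 * \<psi> = - c 0 - c 1 * pi - c 3 * pi - c 5 \<and>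
        d 1 * \<theta> + d 2 * \<phi> + d 3 * \<nu> + d 4 * \<psi> = - d 0 - d 1 * pi - d 3 * pi - d 5)
       \<longleftrightarrow> (\<theta>, \<phi>, \<nu>, \<psi>) = (\<theta>0, \<phi>0, \<nu>0, \<psi>0)) \<and>
    periodic_solution unperturbed_field (2 * pi) (\<lambda>t. (\<theta>0 + t, \<phi>0, \<nu>0 + t, \<psi>0, 1)) \<and>
    limit_cycle_bifurcates_from (perturbed_field a b c d e) (2 * pi) (\<theta>0, \<phi>0, \<nu>0, \<psi>0, 1)"
proof -
  define M :: "real^4^4" where
    "M = vector [vector [a 1, a 2, a 3, a 4], vector [b 1, b 2, b 3, b 4],
                 vector [c 1, c 2, c 3, c 4], vector [d 1, d 2, d 3, d 4]]"
  define rhs :: "(nat \<Rightarrow> real) \<Rightarrow> real" where "rhs f = - f 0 - f 1 * pi - f 3 * pi - f 5" for f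
  have inv: "invertible M"
    using assms by (simp add: M_def invertible_det_nz)
  have Mv: "(M *v x) $ 1 = a 1 * x $ 1 + a 2 * x $ 2 + a 3 * x $ 3 + a 4 * x $ 4"
    "(M *v x) $ 2 = b 1 * x $ 1 + b 2 * x $ 2 + b 3 * x $ 3 + b 4 * x $ 4"
    "(M *v x) $ 3 = c 1 * x $ 1 + c 2 * x $ 2 + c 3 * x $ 3 + c 4 * x $ 4"
    "(M *v x) $ 4 = d 1 * x $ 1 + d 2 * x $ 2 + d 3 * x $ 3 + d 4 * x $ 4" for x
    by (simp_all add: M_def matrix_vector_mult_def sum_4)
  have "bij ((*v) M)"
    using inv by (simp add: invertible_eq_bij)
  then have ex1: "\<exists>!x. M *v x = vector [rhs a, rhs b, rhs c, rhs d]"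
    by (simp add: bij_iff)
  then obtain x where x: "M *v x = vector [rhs a, rhs b, rhs c, rhs d]" by blast
  define \<theta>0 \<phi>0 \<nu>0 \<psi>0 where x0: "\<theta>0 = x $ 1" "\<phi>0 = x $ 2" "\<nu>0 = x $ 3" "\<psi>0 = x $ 4"
  have uniq: "(a 1 * \<theta> + a 2 * \<phi> + a 3 * \<nu> + a 4 * \<psi> = rhs a \<and>
        b 1 * \<theta> + b 2 * \<phi> + b 3 * \<nu> + b 4 * \<psi> = rhs b \<and>
        c 1 * \<theta> + c 2 * \<phi> + c 3 * \<nu> + c 4 * \<psi> = rhs c \<and>
        d 1 * \<theta> + d 2 * \<phi> + d 3 * \<nu> + d 4 * \<psi> = rhs d)
       \<longleftrightarrow> (\<theta>, \<phi>, \<nu>, \<psi>) = (\<theta>0, \<phi>0, \<nu>0, \<psi>0)" (is "?lhs \<longleftrightarrow> ?rhs") for \<theta> \<phi> \<nu> \<psi>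
  proof -
    define y :: "real^4" where "y = vector [\<theta>, \<phi>, \<nu>, \<psi>]"
    have "?lhs \<longleftrightarrow> M *v y = vector [rhs a, rhs b, rhs c, rhs d]"
      by (simp add: vec_eq_iff forall_4 Mv y_def)
    also have "\<dots> \<longleftrightarrow> y = x"
      using ex1 x by blast
    also have "\<dots> \<longleftrightarrow> ?rhs"
      by (simp add: vec_eq_iff forall_4 y_def x0)
    finally show ?thesis .
  qed
  obtain \<kappa> where "\<And>x. (\<Sum>i\<in>UNIV. \<bar>x $ i\<bar>) \<le> \<kappa> * (\<Sum>i\<in>UNIV. \<bar>(M *v x) $ i\<bar>)"
    using invertible_imp_l1_bounded_below[OF inv] by blast
  from this[of "vector [x1, x2, x3, x4]" for x1 x2 x3 x4]
  have \<kappa>: "\<bar>x1\<bar> + \<bar>x2\<bar> + \<bar>x3\<bar> + \<bar>x4\<bar> \<le> \<kappa> *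
      (\<bar>coeffs a \<bullet> (x1, x2, x3, x4, 0)\<bar> + \<bar>coeffs b \<bullet> (x1, x2, x3, x4, 0)\<bar> +
       \<bar>coeffs c \<bullet> (x1, x2, x3, x4, 0)\<bar> + \<bar>coeffs d \<bullet> (x1, x2, x3, x4, 0)\<bar>)" for x1 x2 x3 x4
    by (simp add: sum_4 Mv coeffs_def add.assoc)
  have sol: "affine_form a (\<theta>0 + pi, \<phi>0, \<nu>0 + pi, \<psi>0, 1) = 0" "affine_form b (\<theta>0 + pi, \<phi>0, \<nu>0 + pi, \<psi>0, 1) = 0"
      "affine_form c (\<theta>0 + pi, \<phi>0, \<nu>0 + pi, \<psi>0, 1) = 0" "affine_form d (\<theta>0 + pi, \<phi>0, \<nu>0 + pi, \<psi>0, 1) = 0"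
    using uniq[of \<theta>0 \<phi>0 \<nu>0 \<psi>0] by (simp_all add: rhs_def algebra_simps)
  define z0 :: "real \<Rightarrow> coords" where "z0 = (\<lambda>t. (\<theta>0 + t, \<phi>0, \<nu>0 + t, \<psi>0, 1))"
  obtain \<delta> C where \<delta>: "\<delta> > 0" and ex:
    "\<And>\<epsilon>. 0 < \<epsilon> \<Longrightarrow> \<epsilon> < \<delta> \<Longrightarrow> \<exists>z. limit_cycle (perturbed_field a b c d e \<epsilon>) (2*pi) z \<and>
       (\<forall>t\<in>{0..2*pi}. norm (z t - z0 t) \<le> C * \<epsilon>)"
    using perturbed_limit_cycle_near[OF \<kappa> sol, of e] unfolding z0_def by metis
  \<comment> \<open>One cycle is chosen for each \<open>\<epsilon>\<close>, independently of the
    others; the bound \<open>near\<close> alone controls the family as \<open>\<epsilon>\<close>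
    tends to \<open>0\<close>.\<close>
  then obtain z where cycle: "\<And>\<epsilon>. 0 < \<epsilon> \<Longrightarrow> \<epsilon> < \<delta> \<Longrightarrow> limit_cycle (perturbed_field a b c d e \<epsilon>) (2*pi) (z \<epsilon>)"
    and near: "\<And>\<epsilon> t. 0 < \<epsilon> \<Longrightarrow> \<epsilon> < \<delta> \<Longrightarrow> t \<in> {0..2*pi} \<Longrightarrow> norm (z \<epsilon> t - z0 t) \<le> C * \<epsilon>"
    by metis
  have ev: "\<forall>\<^sub>F \<epsilon> in at_right 0. 0 < \<epsilon> \<and> \<epsilon> < \<delta>"
    using \<delta> eventually_at_right by blast
  have C\<epsilon>: "((\<lambda>\<epsilon>. C * \<epsilon>) \<longlongrightarrow> 0) (at_right 0)"
    by (auto intro!: tendsto_eq_intros)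
  have "limit_cycle_bifurcates_from (perturbed_field a b c d e) (2 * pi) (z0 0)"
    unfolding limit_cycle_bifurcates_from_def
  proof (intro exI[of _ z] conjI impI)
    show "\<forall>\<^sub>F \<epsilon> in at_right 0. limit_cycle (perturbed_field a b c d e \<epsilon>) (2 * pi) (z \<epsilon>)"
      using ev by eventually_elim (auto intro: cycle)
    have "((\<lambda>\<epsilon>. z \<epsilon> 0 - z0 0) \<longlongrightarrow> 0) (at_right 0)"
    proof (rule Lim_null_comparison[OF _ C\<epsilon>])
      show "\<forall>\<^sub>F \<epsilon> in at_right 0. norm (z \<epsilon> 0 - z0 0) \<le> C * \<epsilon>"
        using ev by eventually_elim (auto intro: near)
    qed
    then show "((\<lambda>\<epsilon>. z \<epsilon> 0) \<longlongrightarrow> z0 0) (at_right 0)"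
      by (rule LIM_zero_cancel)
    assume "in_chart (z0 0)"
    \<comment> \<open>The polar angles are constant along the unperturbed orbit, so they keep a
      fixed positive margin from the poles, and \<open>C * \<epsilon>\<close> eventually falls below
      it.\<close>
    then have "min (pi/2 - \<bar>\<phi>0\<bar>) (pi/2 - \<bar>\<psi>0\<bar>) > 0"
      by (auto simp: z0_def)
    with C\<epsilon> have "\<forall>\<^sub>F \<epsilon> in at_right 0. C * \<epsilon> < min (pi/2 - \<bar>\<phi>0\<bar>) (pi/2 - \<bar>\<psi>0\<bar>)"
      by (rule order_tendstoD)
    with ev show "\<forall>\<^sub>F \<epsilon> in at_right 0. \<forall>t\<in>{0..2*pi}. in_chart (z \<epsilon> t)"
    proof eventually_elim
      case (elim \<epsilon>)
      show ?case
      proof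
        fix t assume t: "t \<in> {0..2*pi}"
        obtain y1 y2 y3 y4 y5 where y: "z \<epsilon> t = (y1, y2, y3, y4, y5)"
          by (cases "z \<epsilon> t")
        define v :: coords where "v = (y1 - (\<theta>0 + t), y2 - \<phi>0, y3 - (\<nu>0 + t), y4 - \<psi>0, y5 - 1)"
        have v: "norm v < min (pi/2 - \<bar>\<phi>0\<bar>) (pi/2 - \<bar>\<psi>0\<bar>)"
          using near[OF _ _ t, of \<epsilon>] elim by (simp add: v_def y z0_def)
        have "\<bar>y2 - \<phi>0\<bar> \<le> norm v" "\<bar>y4 - \<psi>0\<bar> \<le> norm v"
          using Cauchy_Schwarz_ineq2[of "(0, 1, 0, 0, 0)" v] Cauchy_Schwarz_ineq2[of "(0, 0, 0, 1, 0)" v]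
          by (simp_all add: v_def norm_Pair)
        with v show "in_chart (z \<epsilon> t)"
          by (auto simp: y)
      qed
    qed
  qed
  moreover have "periodic_solution unperturbed_field (2 * pi) z0"
    unfolding periodic_solution_def
  proof (intro conjI ballI)
    show "(z0 has_vector_derivative unperturbed_field (z0 t)) (at t within {0..2*pi})" for t
      by (auto simp: z0_def has_vector_derivative_Pair_iff intro!: derivative_eq_intros)
    show "same_point (z0 (2*pi)) (z0 0)"
      by (auto simp: z0_def intro!: exI[of _ 1])
    show "\<exists>t\<in>{0..2*pi}. z0 t \<noteq> z0 0"
      by (rule bexI[of _ "2*pi"]) (auto simp: z0_def)
  qed auto
  ultimately show ?thesis
    using uniq unfolding rhs_def z0_def
    by (intro exI[of _ \<theta>0] exI[of _ \<phi>0] exI[of _ \<nu>0] exI[of _ \<psi>0] conjI allI) auto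
qed

end
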